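(* Let $X=(P,Q,R)$ be a homogeneous polynomial vector field on $\mathbb S^2$ of degree $n$. If $X$ has finitely many singularities on $\mathbb S^2$, then $X$ has at most $2(n^2-n+1)$ singularities on $\mathbb S^2$.
   Context: $\mathbb S^2=\{(x,y,z)\in\mathbb R^3: x^2+y^2+z^2=1\}$. A homogeneous polynomial vector field of degree $n$ on $\mathbb S^2$ is a vector field $X=(P,Q,R)$ on $\mathbb R^3$ whose components are real homogeneous polynomials of degree $n$ with $xP+yQ+zR=0$ at all points of $\mathbb S^2$. A singularity of $X$ on $\mathbb S^2$ is a point of $\mathbb S^2$ at which $P=Q=R=0$. *)

theory Defs
  imports "HOL-Analysis.Analysis"
begin

definition monomial_exponents :: "nat \<Rightarrow> (nat \<times> nat \<times> nat) set" where
  "monomial_exponents n = {(i, j, k). i + j + k = n}"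

(* The sum over monomial_exponents n below is a genuine finite sum. *)
lemma finite_monomial_exponents: "finite (monomial_exponents n)"
proof (rule finite_subset)
  show "monomial_exponents n \<subseteq> {..n} \<times> {..n} \<times> {..n}"
    by (auto simp: monomial_exponents_def)
qed simp

(* Real polynomials are identified with the functions they induce (the field is infinite).
   The zero polynomial counts as homogeneous of every degree. *)
definition homogeneous_polynomial :: "nat \<Rightarrow> (real^3 \<Rightarrow> real) \<Rightarrow> bool" where
  "homogeneous_polynomial n f \<longleftrightarrow>
     (\<exists>c :: nat \<Rightarrow> nat \<Rightarrow> nat \<Rightarrow> real. \<forall>v.
        f v = (\<Sum>(i, j, k)\<in>monomial_exponents n. c i j k * (v $ 1) ^ i * (v $ 2) ^ j * (v $ 3) ^ k))"

definition homogeneous_vector_field_on_sphere :: "nat \<Rightarrow> (real^3 \<Rightarrow> real^3) \<Rightarrow> bool" where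
  "homogeneous_vector_field_on_sphere n X \<longleftrightarrow>
     (\<forall>i. homogeneous_polynomial n (\<lambda>v. X v $ i)) \<and>
     (\<forall>v\<in>sphere 0 1. v $ 1 * X v $ 1 + v $ 2 * X v $ 2 + v $ 3 * X v $ 3 = 0)"

definition sphere_singularities :: "(real^3 \<Rightarrow> real^3) \<Rightarrow> (real^3) set" where
  "sphere_singularities X = {v \<in> sphere 0 1. X v = 0}"

end

theory Submission
  imports Defs "HOL-Computational_Algebra.Polynomial_Factorial" "HOL-Computational_Algebra.Field_as_Ring"
begin

text \<open>
  After a shear no singularity lies on the plane at infinity of an affine chart, and the antipodal
  pairs of singularities become the common zeros of two polynomials \<open>P, Q \<in> \<real>[x, y]\<close> such that
  \<open>P\<close>, \<open>Q\<close> and, by tangency, \<open>x P + y Q\<close> all have total degree at most \<open>n\<close>.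

  If \<open>P\<close> and \<open>Q\<close> are coprime, the space of all \<open>A P + B Q\<close> of large degree \<open>\<le> k\<close> vanishes at
  the common zeros, and its codimension bounds their number. The syzygies
  are the multiples of \<open>(Q, -P)\<close>, so counting the pairs \<open>(A, B)\<close> gives Bezout's bound. By tangency
  the pairs \<open>(x C, y C)\<close> may have degree one higher than the other pairs, which
  lowers the bound from \<open>n\<^sup>2\<close> to \<open>n\<^sup>2 - n + 1\<close>.

  In general let \<open>f\<close> be the gcd of \<open>P\<close> and \<open>Q\<close>, of degree \<open>d\<close>. If \<open>f\<close> has finitely many real
  zeros, then its \<open>y\<close>-derivative vanishes at all of them, and splitting off the gcd of \<open>f\<close> and this
  derivative shows that there are at most \<open>d\<^sup>2\<close> of them. With \<open>m = n - d > 0\<close> the two bounds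
  combine, since \<open>(m\<^sup>2 - m + 1) + d\<^sup>2 \<le> n\<^sup>2 - n + 1\<close>.
\<close>

subsection \<open>Counting lemmas\<close>

text \<open>Gaussian elimination, one equation at a time: an equation with a nonzero coefficient
  removes one unknown, so the surplus of unknowns over equations survives the induction.\<close>

lemma homogeneous_system_nontrivial_solution:
  fixes a :: "'e \<Rightarrow> 'i \<Rightarrow> 'a::field"
  assumes "finite E" "finite I" "card E < card I"
  shows "\<exists>c. (\<exists>i\<in>I. c i \<noteq> 0) \<and> (\<forall>e\<in>E. (\<Sum>i\<in>I. c i * a e i) = 0)"
  using assms
proof (induction E arbitrary: a I rule: finite_induct)
  case empty
  then show ?case
    by (intro exI[of _ "\<lambda>_. 1"]) (auto simp: card_gt_0_iff)
next
  case (insert e E)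
  show ?case
  proof (cases "\<forall>i\<in>I. a e i = 0")
    case True
    with insert.IH[of I a] insert.prems insert.hyps show ?thesis
      by auto
  next
    case False
    then obtain k where k: "k \<in> I" "a e k \<noteq> 0"
      by blast
    define J where "J = I - {k}"
    have J: "finite J" "k \<notin> J" "I = insert k J"
      using insert.prems k by (auto simp: J_def)
    have "card E < card J"
      using insert.prems insert.hyps J by simp
    from insert.IH[OF J(1) this, of "\<lambda>f i. a f i - a f k * a e i / a e k"]
    obtain c where c: "\<exists>i\<in>J. c i \<noteq> 0"
      "\<forall>f\<in>E. (\<Sum>i\<in>J. c i * (a f i - a f k * a e i / a e k)) = 0"
      by blast
    \<comment> \<open>The value at the pivot \<open>k\<close> is forced by equation
      \<open>e\<close>; substituting it into any other equation gives exactly the reduced equation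
      that \<open>c\<close> solves.\<close>
    define d where "d = c(k := - (\<Sum>i\<in>J. c i * a e i) / a e k)"
    have sum: "(\<Sum>i\<in>I. d i * a f i) = (\<Sum>i\<in>J. c i * (a f i - a f k * a e i / a e k))" for f
    proof -
      have "(\<Sum>i\<in>I. d i * a f i) = d k * a f k + (\<Sum>i\<in>J. d i * a f i)"
        using J by simp
      also have "(\<Sum>i\<in>J. d i * a f i) = (\<Sum>i\<in>J. c i * a f i)"
        using J(2) by (intro sum.cong) (auto simp: d_def)
      also have "d k * a f k = - (\<Sum>i\<in>J. c i * (a f k * a e i / a e k))"
        by (simp add: d_def sum_distrib_right sum_distrib_left sum_divide_distrib mult_ac)
      finally show ?thesis
        by (simp add: sum_subtractf right_diff_distrib)
    qed
    have "\<exists>i\<in>I. d i \<noteq> 0"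
      using c(1) J by (auto simp: d_def)
    moreover have "(\<Sum>i\<in>I. d i * a f i) = 0" if "f \<in> insert e E" for f
    proof (cases "f = e")
      case True
      then show ?thesis using k by (simp only: sum) simp
    next
      case False
      with that c(2) show ?thesis by (simp only: sum) simp
    qed
    ultimately show ?thesis by blast
  qed
qed

lemma triangle_eq_Sigma: "{(s, t). s + t < d} = Sigma {..<d} (\<lambda>s. {..<d - s})" for d :: nat
  by auto

lemma finite_triangle: "finite {(s, t). s + t < d}" for d :: nat
  by (simp add: triangle_eq_Sigma)

text \<open>With \<open>d = Suc k\<close> this counts the monomials of total degree at most
  \<open>k\<close>. The doubled form keeps division out of the later dimension counts.\<close>

lemma card_triangle: "2 * card {(s, t). s + t < d} = d * (d + 1)" for d :: nat
proof -
  have "card {(s, t). s + t < d} = (\<Sum>s<d. d - s)"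
    by (simp add: triangle_eq_Sigma card_SigmaI)
  also have "\<dots> = (\<Sum>s<d. Suc s)"
    by (rule sum.reindex_bij_witness[of _ "\<lambda>s. d - Suc s" "\<lambda>s. d - Suc s"]) auto
  also have "2 * \<dots> = d * (d + 1)"
    by (induction d) auto
  finally show ?thesis .
qed

subsection \<open>Bivariate polynomials and their total degree\<close>

text \<open>The outer variable is \<open>y\<close>, the inner one \<open>x\<close>.\<close>

type_synonym bipoly = "real poly poly"

definition eval2 :: "bipoly \<Rightarrow> real \<Rightarrow> real \<Rightarrow> real" where
  "eval2 f x y = poly (poly f [:y:]) x"

definition coeff2 :: "bipoly \<Rightarrow> nat \<Rightarrow> nat \<Rightarrow> real" where
  "coeff2 f s t = coeff (coeff f t) s"

definition const2 :: "real \<Rightarrow> bipoly" where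
  "const2 c = [:[:c:]:]"

definition varx :: bipoly where "varx = [:[:0, 1:]:]"
definition vary :: bipoly where "vary = [:0, 1:]"

definition monom2 :: "nat \<Rightarrow> nat \<Rightarrow> bipoly" where
  "monom2 s t = monom (monom 1 s) t"

text \<open>A bound rather than a degree function: the zero polynomial then needs no
  convention.\<close>

definition tdeg_le :: "bipoly \<Rightarrow> nat \<Rightarrow> bool" where
  "tdeg_le f d \<longleftrightarrow> (\<forall>s t. d < s + t \<longrightarrow> coeff2 f s t = 0)"

lemma eval2_simps [simp]:
  "eval2 0 x y = 0" "eval2 1 x y = 1" "eval2 (f + g) x y = eval2 f x y + eval2 g x y"
  "eval2 (f - g) x y = eval2 f x y - eval2 g x y" "eval2 (- f) x y = - eval2 f x y"
  "eval2 (f * g) x y = eval2 f x y * eval2 g x y" "eval2 (f ^ m) x y = eval2 f x y ^ m"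
  "eval2 (const2 c) x y = c" "eval2 varx x y = x" "eval2 vary x y = y"
  by (simp_all add: eval2_def const2_def varx_def vary_def)

lemma eval2_sum: "eval2 (sum f A) x y = (\<Sum>i\<in>A. eval2 (f i) x y)"
  by (induction A rule: infinite_finite_induct) auto

lemma eval2_prod: "eval2 (prod f A) x y = (\<Prod>i\<in>A. eval2 (f i) x y)"
  by (induction A rule: infinite_finite_induct) auto

lemma bipoly_eqI: "(\<And>s t. coeff2 f s t = coeff2 g s t) \<Longrightarrow> f = g"
  by (simp add: coeff2_def poly_eq_iff)

lemma coeff2_simps [simp]:
  "coeff2 0 s t = 0" "coeff2 (f + g) s t = coeff2 f s t + coeff2 g s t"
  "coeff2 (f - g) s t = coeff2 f s t - coeff2 g s t" "coeff2 (- f) s t = - coeff2 f s t"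
  "coeff2 (const2 c * f) s t = c * coeff2 f s t"
  "coeff2 (monom2 i j) s t = (if s = i \<and> t = j then 1 else 0)"
  by (auto simp: coeff2_def const2_def monom2_def)

lemma coeff2_sum: "coeff2 (sum f A) s t = (\<Sum>i\<in>A. coeff2 (f i) s t)"
  by (induction A rule: infinite_finite_induct) auto

lemma coeff2_mult: "coeff2 (f * g) s t = (\<Sum>(j, i)\<in>{..s} \<times> {..t}. coeff2 f j i * coeff2 g (s - j) (t - i))"
proof -
  have "coeff2 (f * g) s t = (\<Sum>i\<le>t. \<Sum>j\<le>s. coeff2 f j i * coeff2 g (s - j) (t - i))"
    by (simp add: coeff2_def coeff_mult coeff_sum)
  also have "\<dots> = (\<Sum>j\<le>s. \<Sum>i\<le>t. coeff2 f j i * coeff2 g (s - j) (t - i))"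
    by (rule sum.swap)
  finally show ?thesis
    by (simp add: sum.cartesian_product)
qed

lemma finite_coeff2_support: "finite {(s, t). coeff2 f s t \<noteq> 0}"
proof -
  have "{(s, t). coeff2 f s t \<noteq> 0} \<subseteq> (\<Union>t\<in>{..degree f}. {..degree (coeff f t)} \<times> {t})"
    by (auto simp: coeff2_def intro!: le_degree)
  then show ?thesis
    by (rule finite_subset) auto
qed

text \<open>For fixed \<open>y\<close> the polynomial in \<open>x\<close> has every real as a root
  and vanishes, so every constant \<open>[:y:]\<close> is a root of \<open>f\<close> over the ring
  of polynomials in \<open>x\<close>.\<close>

lemma eq_0_if_eval2_eq_0:
  assumes "\<And>x y. eval2 f x y = 0"
  shows "f = 0"
proof -
  have "poly f [:y:] = 0" for y
    using assms by (intro poly_all_0_iff_0[THEN iffD1]) (simp add: eval2_def)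
  then have "range (\<lambda>y::real. [:y:]) \<subseteq> {c. poly f c = 0}"
    by auto
  moreover have "infinite (range (\<lambda>y::real. [:y:]))"
    using infinite_UNIV_char_0[where 'a = real] by (subst finite_image_iff) (auto intro: injI)
  ultimately show ?thesis
    using poly_roots_finite[of f] finite_subset by blast
qed

lemma tdeg_le_const [simp]: "tdeg_le 0 d" "tdeg_le 1 d" "tdeg_le (const2 c) d"
  by (auto simp: tdeg_le_def coeff2_def const2_def one_pCons coeff_pCons split: nat.splits)

lemma tdeg_le_mono: "tdeg_le f d \<Longrightarrow> d \<le> e \<Longrightarrow> tdeg_le f e"
  by (auto simp: tdeg_le_def)

lemma tdeg_le_add: "tdeg_le f d \<Longrightarrow> tdeg_le g d \<Longrightarrow> tdeg_le (f + g) d"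
  by (auto simp: tdeg_le_def)

lemma tdeg_le_uminus: "tdeg_le f d \<Longrightarrow> tdeg_le (- f) d"
  by (auto simp: tdeg_le_def)

lemma tdeg_le_diff: "tdeg_le f d \<Longrightarrow> tdeg_le g d \<Longrightarrow> tdeg_le (f - g) d"
  by (auto simp: tdeg_le_def)

lemma tdeg_le_sum: "(\<And>i. i \<in> A \<Longrightarrow> tdeg_le (f i) d) \<Longrightarrow> tdeg_le (sum f A) d"
  by (auto simp: tdeg_le_def coeff2_sum)

lemma tdeg_le_scale: "tdeg_le f d \<Longrightarrow> tdeg_le (const2 c * f) d"
  by (auto simp: tdeg_le_def)

lemma tdeg_le_mult:
  assumes "tdeg_le f d" "tdeg_le g e"
  shows "tdeg_le (f * g) (d + e)"
  unfolding tdeg_le_def coeff2_mult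
proof (intro allI impI sum.neutral ballI, unfold split_paired_all prod.case)
  fix s t j i
  assume "d + e < s + t" "(j, i) \<in> {..s} \<times> {..t}"
  then have "d < j + i \<or> e < (s - j) + (t - i)"
    by auto
  then show "coeff2 f j i * coeff2 g (s - j) (t - i) = 0"
    using assms by (auto simp: tdeg_le_def)
qed

lemma tdeg_le_power: "tdeg_le f 1 \<Longrightarrow> tdeg_le (f ^ m) m"
  by (induction m) (use tdeg_le_mult[of f 1] in auto)

lemma tdeg_le_varx: "tdeg_le varx 1" and tdeg_le_vary: "tdeg_le vary 1"
  by (auto simp: tdeg_le_def coeff2_def varx_def vary_def coeff_pCons split: nat.splits)

lemma tdeg_le_prod: "finite A \<Longrightarrow> (\<And>i. i \<in> A \<Longrightarrow> tdeg_le (f i) 1) \<Longrightarrow> tdeg_le (prod f A) (card A)"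
  by (induction A rule: finite_induct) (use tdeg_le_mult[of _ 1] in auto)

text \<open>Leading exponents in the graded lexicographic order with \<open>x < y\<close>.\<close>

definition lead_at :: "bipoly \<Rightarrow> nat \<Rightarrow> nat \<Rightarrow> bool" where
  "lead_at f s t \<longleftrightarrow> coeff2 f s t \<noteq> 0 \<and>
     (\<forall>i j. coeff2 f i j \<noteq> 0 \<longrightarrow> i + j < s + t \<or> i + j = s + t \<and> j \<le> t)"

lemma lead_at_exists:
  assumes "f \<noteq> 0"
  obtains s t where "lead_at f s t"
proof -
  define S where "S = {(s, t). coeff2 f s t \<noteq> 0}"
  have S: "finite S" "S \<noteq> {}"
    using finite_coeff2_support assms bipoly_eqI[of f 0] by (auto simp: S_def)
  \<comment> \<open>Maximise the total degree first, then the exponent of \<open>y\<close> among the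
    monomials that attain it.\<close>
  define d where "d = Max ((\<lambda>(s, t). s + t) ` S)"
  have d: "d \<in> (\<lambda>(s, t). s + t) ` S" "\<And>s t. (s, t) \<in> S \<Longrightarrow> s + t \<le> d"
    unfolding d_def using S by (auto intro: Max_in Max_ge)
  define T where "T = {t. \<exists>s. (s, t) \<in> S \<and> s + t = d}"
  have "T \<subseteq> snd ` S" by (force simp: T_def)
  then have T: "finite T" "T \<noteq> {}"
    using S(1) d(1) finite_subset[of T "snd ` S"] by (auto simp: T_def)
  then have m: "Max T \<in> T" "\<And>t. t \<in> T \<Longrightarrow> t \<le> Max T"
    by auto
  from m(1) obtain s where "(s, Max T) \<in> S" "s + Max T = d"
    by (auto simp: T_def)
  moreover have "i + j < d \<or> i + j = d \<and> j \<le> Max T" if "coeff2 f i j \<noteq> 0" for i j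
    using d(2)[of i j] m(2)[of j] that by (auto simp: S_def T_def)
  ultimately have "lead_at f s (Max T)"
    by (auto simp: lead_at_def S_def)
  then show ?thesis by (rule that)
qed

lemma lead_at_nonzero: "lead_at f s t \<Longrightarrow> f \<noteq> 0"
  by (auto simp: lead_at_def)

lemma tdeg_le_iff_lead_at: "lead_at f s t \<Longrightarrow> tdeg_le f d \<longleftrightarrow> s + t \<le> d"
  unfolding lead_at_def tdeg_le_def
proof
  assume *: "coeff2 f s t \<noteq> 0 \<and> (\<forall>i j. coeff2 f i j \<noteq> 0 \<longrightarrow> i + j < s + t \<or> i + j = s + t \<and> j \<le> t)"
  show "s + t \<le> d" if "\<forall>s t. d < s + t \<longrightarrow> coeff2 f s t = 0"
    using * that by (meson not_less)
  show "\<forall>i j. d < i + j \<longrightarrow> coeff2 f i j = 0" if "s + t \<le> d"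
    using * that by force
qed

text \<open>In a nonzero summand neither factor exceeds its leading exponents, yet the exponents add
  up to the sum of the leading ones; hence both factors sit at their leading exponents.\<close>

lemma coeff2_mult_lead_at:
  assumes "lead_at f s t" "lead_at g s' t'"
  shows "coeff2 (f * g) (s + s') (t + t') = coeff2 f s t * coeff2 g s' t'"
proof -
  have "coeff2 (f * g) (s + s') (t + t') =
    (\<Sum>(j, i)\<in>{(s, t)}. coeff2 f j i * coeff2 g (s + s' - j) (t + t' - i))"
    unfolding coeff2_mult
  proof (rule sum.mono_neutral_right)
    show "\<forall>u\<in>{..s + s'} \<times> {..t + t'} - {(s, t)}.
       (case u of (j, i) \<Rightarrow> coeff2 f j i * coeff2 g (s + s' - j) (t + t' - i)) = 0"
    proof (intro ballI, unfold split_paired_all prod.case)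
      fix j i
      assume ji: "(j, i) \<in> {..s + s'} \<times> {..t + t'} - {(s, t)}"
      show "coeff2 f j i * coeff2 g (s + s' - j) (t + t' - i) = 0"
      proof (rule ccontr)
        assume "coeff2 f j i * coeff2 g (s + s' - j) (t + t' - i) \<noteq> 0"
        then have "coeff2 f j i \<noteq> 0" "coeff2 g (s + s' - j) (t + t' - i) \<noteq> 0"
          by auto
        then have "j + i < s + t \<or> j + i = s + t \<and> i \<le> t"
          "(s + s' - j) + (t + t' - i) < s' + t' \<or>
           (s + s' - j) + (t + t' - i) = s' + t' \<and> t + t' - i \<le> t'"
          using assms by (auto simp: lead_at_def)
        with ji show False by auto
      qed
    qed
  qed auto
  then show ?thesis by simp
qed

lemma lead_at_mult:
  assumes "lead_at f s t" "lead_at g s' t'"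
  shows "lead_at (f * g) (s + s') (t + t')"
  unfolding lead_at_def
proof (intro conjI allI impI)
  show "coeff2 (f * g) (s + s') (t + t') \<noteq> 0"
    using assms coeff2_mult_lead_at[OF assms] unfolding lead_at_def by simp
  fix i j
  assume "coeff2 (f * g) i j \<noteq> 0"
  then obtain u v where uv: "u \<le> i" "v \<le> j" "coeff2 f u v \<noteq> 0" "coeff2 g (i - u) (j - v) \<noteq> 0"
    unfolding coeff2_mult by (elim sum.not_neutral_contains_not_neutral) auto
  from uv(3,4) have "u + v < s + t \<or> u + v = s + t \<and> v \<le> t"
     "(i - u) + (j - v) < s' + t' \<or> (i - u) + (j - v) = s' + t' \<and> (j - v) \<le> t'"
    using assms unfolding lead_at_def by blast+
  with uv(1,2) show "i + j < s + s' + (t + t') \<or> i + j = s + s' + (t + t') \<and> j \<le> t + t'"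
    by auto
qed

subsection \<open>Coprime polynomials\<close>

lemma eval2_scaled_sum: "eval2 (\<Sum>i\<in>A. const2 (c i) * f i) x y = (\<Sum>i\<in>A. c i * eval2 (f i) x y)"
  by (simp add: eval2_sum)

lemma interpolation_polynomial:
  assumes "finite Z" "z \<in> Z"
  obtains e where "tdeg_le e (card Z)" "eval2 e (fst z) (snd z) \<noteq> 0"
    "\<And>w. w \<in> Z \<Longrightarrow> w \<noteq> z \<Longrightarrow> eval2 e (fst w) (snd w) = 0"
proof -
  \<comment> \<open>The inner product of \<open>z - w\<close> with \<open>(x, y) - w\<close>: it
    vanishes at \<open>w\<close> and equals the squared distance of \<open>z\<close> and
    \<open>w\<close> at \<open>z\<close>.\<close>
  define L where "L = (\<lambda>w. const2 (fst z - fst w) * (varx - const2 (fst w)) +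
    const2 (snd z - snd w) * (vary - const2 (snd w)))"
  have L: "tdeg_le (L w) 1" for w
    unfolding L_def
    by (intro tdeg_le_add tdeg_le_scale tdeg_le_diff tdeg_le_varx tdeg_le_vary tdeg_le_const)
  have nz: "eval2 (L w) (fst z) (snd z) \<noteq> 0" if "w \<noteq> z" for w
    using that sum_power2_gt_zero_iff[of "fst z - fst w" "snd z - snd w"]
    by (auto simp: L_def power2_eq_square prod_eq_iff)
  show ?thesis
  proof (rule that[of "prod L (Z - {z})"])
    show "tdeg_le (prod L (Z - {z})) (card Z)"
      using assms L by (intro tdeg_le_mono[OF tdeg_le_prod]) (auto intro: card_mono)
    show "eval2 (prod L (Z - {z})) (fst z) (snd z) \<noteq> 0"
      using assms nz by (auto simp: eval2_prod)
    show "eval2 (prod L (Z - {z})) (fst w) (snd w) = 0" if "w \<in> Z" "w \<noteq> z" for w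
      using assms that by (auto simp: eval2_prod L_def intro!: bexI[of _ w])
  qed
qed

lemma coprime_syzygy:
  fixes P Q :: "'a :: {factorial_ring_gcd, semiring_gcd_mult_normalize}"
  assumes "coprime P Q" "Q \<noteq> 0" "A * P + B * Q = 0"
  obtains D where "A = D * Q" "B = - (D * P)"
proof -
  have "A * P = (- B) * Q"
    using assms(3) by (simp add: add_eq_0_iff)
  then have "Q dvd A * P"
    by (metis dvd_triv_right)
  then have "Q dvd A"
    using assms(1) by (simp add: coprime_commute coprime_dvd_mult_left_iff)
  then obtain D where D: "A = D * Q"
    by (metis dvd_def mult.commute)
  then have "Q * (D * P + B) = 0"
    using assms(3) by (simp add: algebra_simps)
  with assms(2) have "B = - (D * P)"
    by (simp add: add_eq_0_iff2)
  with D show ?thesis by (rule that)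
qed

text \<open>
  If the inequality failed, a nontrivial combination of interpolation polynomials at \<open>Z\<close> and of the
  \<open>A i * P + B i * Q\<close> would vanish while the corresponding combination \<open>D * Q\<close> of the \<open>A i\<close> has zero
  coefficients at all exponents where \<open>D * Q\<close> could have its leading coefficient.
\<close>

lemma card_zeros_plus_card_family_le:
  fixes P Q :: bipoly and Z :: "(real \<times> real) set" and A B :: "'i \<Rightarrow> bipoly"
  assumes coprime: "coprime P Q" and lead: "lead_at Q s0 t0"
    and Z: "finite Z" "\<And>z. z \<in> Z \<Longrightarrow> eval2 P (fst z) (snd z) = 0"
      "\<And>z. z \<in> Z \<Longrightarrow> eval2 Q (fst z) (snd z) = 0" "card Z \<le> k"
    and I: "finite I" "\<And>i. i \<in> I \<Longrightarrow> tdeg_le (A i) (j + s0 + t0)"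
      "\<And>i. i \<in> I \<Longrightarrow> tdeg_le (A i * P + B i * Q) k"
    and indep: "\<And>c. (\<Sum>i\<in>I. const2 (c i) * A i) = 0 \<Longrightarrow>
      (\<Sum>i\<in>I. const2 (c i) * B i) = 0 \<Longrightarrow> \<forall>i\<in>I. c i = 0"
  shows "card Z + card I \<le> card {(s, t). s + t < Suc k} + card {(s, t). s + t < Suc j}"
proof (rule ccontr)
  assume "\<not> ?thesis"
  \<comment> \<open>The unknowns are the coefficients of a combination over \<open>Z <+> I\<close>.
    The left equations annihilate all its coefficients up to degree \<open>k\<close>; the right ones
    annihilate the coefficients of \<open>AA\<close> at \<open>(s0 + s, t0 + t)\<close> with
    \<open>s + t\<close> at most \<open>j\<close>.\<close>
  moreover define E where "E = {(s, t). s + t < Suc k} <+> {(s, t). s + t < Suc j}"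
  ultimately have card: "card E < card (Z <+> I)" and fin: "finite E" "finite (Z <+> I)"
    using Z(1) I(1) finite_triangle by (auto simp: card_Plus)
  have "\<exists>e. tdeg_le e (card Z) \<and> eval2 e (fst z) (snd z) \<noteq> 0 \<and>
    (\<forall>w\<in>Z. w \<noteq> z \<longrightarrow> eval2 e (fst w) (snd w) = 0)" if "z \<in> Z" for z
    using interpolation_polynomial[OF Z(1) that] by metis
  then obtain e where e: "\<And>z. z \<in> Z \<Longrightarrow> tdeg_le (e z) (card Z)"
    "\<And>z. z \<in> Z \<Longrightarrow> eval2 (e z) (fst z) (snd z) \<noteq> 0"
    "\<And>z w. z \<in> Z \<Longrightarrow> w \<in> Z \<Longrightarrow> w \<noteq> z \<Longrightarrow> eval2 (e z) (fst w) (snd w) = 0"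
    by metis
  define F where "F = case_sum e (\<lambda>i. A i * P + B i * Q)"
  define G where "G = case_sum (\<lambda>_ :: real \<times> real. 0) A"
  define a where "a = case_sum (\<lambda>(s, t) u. coeff2 (F u) s t) (\<lambda>(s, t) u. coeff2 (G u) (s0 + s) (t0 + t))"
  obtain c where c: "\<exists>u\<in>Z <+> I. c u \<noteq> 0" "\<forall>e\<in>E. (\<Sum>u\<in>Z <+> I. c u * a e u) = 0"
    using homogeneous_system_nontrivial_solution[OF fin card, of a] by blast
  define AA where "AA = (\<Sum>i\<in>I. const2 (c (Inr i)) * A i)"
  define BB where "BB = (\<Sum>i\<in>I. const2 (c (Inr i)) * B i)"
  define ZZ where "ZZ = (\<Sum>z\<in>Z. const2 (c (Inl z)) * e z)"
  have sumF: "(\<Sum>u\<in>Z <+> I. const2 (c u) * F u) = ZZ + (AA * P + BB * Q)"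
    using Z(1) I(1)
    by (simp add: sum.Plus F_def AA_def BB_def ZZ_def sum_distrib_left sum.distrib algebra_simps)
  have sumG: "(\<Sum>u\<in>Z <+> I. const2 (c u) * G u) = AA"
    using Z(1) I(1) by (simp add: sum.Plus G_def AA_def)
  have degF: "tdeg_le (F u) k" if "u \<in> Z <+> I" for u
    using that tdeg_le_mono[OF e(1) Z(4)] I(3) by (auto simp: F_def)
  have zero: "ZZ + (AA * P + BB * Q) = 0"
    unfolding sumF[symmetric]
  proof (rule bipoly_eqI)
    fix s t
    show "coeff2 (\<Sum>u\<in>Z <+> I. const2 (c u) * F u) s t = coeff2 0 s t"
    proof (cases "s + t \<le> k")
      case True
      then have "Inl (s, t) \<in> E"
        by (auto simp: E_def)
      with c(2) have "(\<Sum>u\<in>Z <+> I. c u * a (Inl (s, t)) u) = 0"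
        by blast
      then show ?thesis
        by (simp add: coeff2_sum a_def)
    next
      case False
      with degF show ?thesis
        by (simp add: coeff2_sum tdeg_le_def sum.neutral)
    qed
  qed
  \<comment> \<open>At \<open>z\<close> both \<open>P\<close> and \<open>Q\<close> vanish, and so do
    all interpolation polynomials except \<open>e z\<close>.\<close>
  have cZ: "c (Inl z) = 0" if "z \<in> Z" for z
  proof -
    have "eval2 (ZZ + (AA * P + BB * Q)) (fst z) (snd z) = eval2 ZZ (fst z) (snd z)"
      using that Z by simp
    also have "\<dots> = (\<Sum>w\<in>{z}. c (Inl w) * eval2 (e w) (fst z) (snd z))"
      unfolding ZZ_def eval2_scaled_sum
    proof (rule sum.mono_neutral_right)
      show "\<forall>w\<in>Z - {z}. c (Inl w) * eval2 (e w) (fst z) (snd z) = 0"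
        using e(3)[OF _ that] by (metis DiffE insertI1 mult_zero_right)
    qed (use that Z(1) in auto)
    finally show ?thesis
      using e(2)[OF that] zero by simp
  qed
  then have "ZZ = 0"
    by (simp add: ZZ_def const2_def)
  with zero have "AA * P + BB * Q = 0"
    by simp
  then obtain D where D: "AA = D * Q" "BB = - (D * P)"
    using coprime lead_at_nonzero[OF lead] by (elim coprime_syzygy)
  have "D = 0"
  proof (rule ccontr)
    assume "D \<noteq> 0"
    then obtain s t where st: "lead_at D s t"
      by (rule lead_at_exists)
    from lead_at_mult[OF lead st] have lm: "lead_at AA (s0 + s) (t0 + t)"
      by (simp add: D mult.commute)
    have "tdeg_le AA (j + s0 + t0)"
      unfolding AA_def
      using I(2) by (intro tdeg_le_sum tdeg_le_scale)
    \<comment> \<open>The degree bound on \<open>AA\<close> places the leading exponents of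
      \<open>D * Q\<close> among those annihilated by the right equations.\<close>
    with lm have "s + t \<le> j"
      by (simp add: tdeg_le_iff_lead_at)
    then have "Inr (s, t) \<in> E"
      by (auto simp: E_def)
    with c(2) have "(\<Sum>u\<in>Z <+> I. c u * a (Inr (s, t)) u) = 0"
      by blast
    then have "coeff2 AA (s0 + s) (t0 + t) = 0"
      unfolding sumG[symmetric] by (simp add: coeff2_sum a_def)
    with lm show False
      by (simp add: lead_at_def)
  qed
  with D have "AA = 0" "BB = 0"
    by simp_all
  then have "\<forall>i\<in>I. c (Inr i) = 0"
    unfolding AA_def BB_def by (rule indep)
  with cZ c(1) show False
    by (metis PlusE)
qed

section \<open>Monomial families and Bezout's bounds\<close>

lemma coeff2_monom_combination:
  assumes "finite T"
  shows "coeff2 (\<Sum>p\<in>T. const2 (c p) * monom2 (fst p) (snd p)) s t =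
    (if (s, t) \<in> T then c (s, t) else 0)"
proof -
  have "coeff2 (\<Sum>p\<in>T. const2 (c p) * monom2 (fst p) (snd p)) s t =
    (\<Sum>p\<in>T. if (s, t) = p then c p else 0)"
    unfolding coeff2_sum by (rule sum.cong) (auto simp: prod_eq_iff)
  then show ?thesis
    using assms by simp
qed

lemma monom_combination_eq_0:
  assumes "finite T" "(\<Sum>p\<in>T. const2 (c p) * monom2 (fst p) (snd p)) = 0" "p \<in> T"
  shows "c p = 0"
  using coeff2_monom_combination[OF assms(1), of c "fst p" "snd p"] assms(2,3) by simp

lemma tdeg_le_monom2: "s + t \<le> d \<Longrightarrow> tdeg_le (monom2 s t) d"
  by (auto simp: tdeg_le_def)

lemma card_antidiagonal: "card {(s, t). s + t = d} = Suc d" for d :: nat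
proof -
  have "{(s, t). s + t = d} = (\<lambda>s. (s, d - s)) ` {..d}"
    by force
  moreover have "inj_on (\<lambda>s. (s, d - s)) {..d}"
    by (auto simp: inj_on_def)
  ultimately show ?thesis
    by (simp add: card_image)
qed

lemma finite_antidiagonal: "finite {(s, t). s + t = d}" for d :: nat
  by (rule finite_subset[OF _ finite_triangle[of "Suc d"]]) auto

lemma lead_at_varx: "lead_at varx 1 0" and lead_at_vary: "lead_at vary 0 1"
  by (auto simp: lead_at_def coeff2_def varx_def vary_def coeff_pCons split: nat.splits)

text \<open>The family consists of the pairs \<open>(M, 0)\<close> and \<open>(0, M)\<close> for
  monomials \<open>M\<close> of degree at most \<open>i\<close>. Let \<open>N(r)\<close> be the
  number of monomials of degree at most \<open>r\<close>; the count gives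
  \<open>card Z + 2 N(i) \<le> N(i + a) + N(i - a)\<close>, and the second difference of the
  quadratic \<open>N\<close> is \<open>a\<^sup>2\<close>.\<close>

lemma bezout_lead:
  fixes P Q :: bipoly
  assumes coprime: "coprime P Q" and lead: "lead_at Q s0 t0" and P: "tdeg_le P (s0 + t0)"
    and Z: "finite Z" "\<And>z. z \<in> Z \<Longrightarrow> eval2 P (fst z) (snd z) = 0"
      "\<And>z. z \<in> Z \<Longrightarrow> eval2 Q (fst z) (snd z) = 0"
  shows "card Z \<le> (s0 + t0)\<^sup>2"
proof -
  \<comment> \<open>This choice makes \<open>i - a\<close> equal to \<open>card Z\<close>, a natural
    number, and ensures that \<open>i + a\<close> is at least \<open>card Z\<close>, as the
    interpolation polynomials require.\<close>
  define a i where "a = s0 + t0" and "i = card Z + a"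
  define T :: "(nat \<times> nat) set" where "T = {(s, t). s + t < Suc i}"
  define A where "A = case_sum (\<lambda>p. monom2 (fst p) (snd p)) (\<lambda>p :: nat \<times> nat. 0)"
  define B where "B = case_sum (\<lambda>p :: nat \<times> nat. 0) (\<lambda>p. monom2 (fst p) (snd p))"
  have T: "finite T"
    unfolding T_def by (rule finite_triangle)
  have Q: "tdeg_le Q a"
    using lead by (simp add: a_def tdeg_le_iff_lead_at)
  have mon: "tdeg_le (monom2 (fst p) (snd p)) i" if "p \<in> T" for p
    using that by (intro tdeg_le_monom2) (auto simp: T_def)
  have "card Z + card (T <+> T) \<le>
    card {(s, t). s + t < Suc (i + a)} + card {(s, t). s + t < Suc (card Z)}"
  proof (rule card_zeros_plus_card_family_le[OF coprime lead Z])
    show "finite (T <+> T)"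
      using T by simp
    show "tdeg_le (A u) (card Z + s0 + t0)" if "u \<in> T <+> T" for u
      using that mon by (auto simp: A_def i_def a_def add.assoc)
    show "tdeg_le (A u * P + B u * Q) (i + a)" if "u \<in> T <+> T" for u
      using that mon P Q tdeg_le_mult[of _ i _ a] by (auto simp: A_def B_def a_def)
    show "\<forall>u\<in>T <+> T. c u = 0"
      if "(\<Sum>u\<in>T <+> T. const2 (c u) * A u) = 0" "(\<Sum>u\<in>T <+> T. const2 (c u) * B u) = 0" for c
      using that monom_combination_eq_0[OF T, of "\<lambda>p. c (Inl p)"]
        monom_combination_eq_0[OF T, of "\<lambda>p. c (Inr p)"] T
      by (auto simp: sum.Plus A_def B_def)
  qed (auto simp: i_def)
  then have "2 * card Z + 2 * (2 * card T) \<le>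
      2 * card {(s, t). s + t < Suc (i + a)} + 2 * card {(s, t). s + t < Suc (card Z)}"
    using T by (simp add: card_Plus)
  then have "2 * card Z + 2 * (Suc i * (Suc i + 1)) \<le>
      Suc (i + a) * (Suc (i + a) + 1) + Suc (card Z) * (Suc (card Z) + 1)"
    unfolding T_def card_triangle .
  then have "card Z \<le> a\<^sup>2"
    by (simp add: i_def power2_eq_square algebra_simps)
  then show ?thesis
    by (simp add: a_def)
qed

text \<open>The family of \<open>bezout_lead\<close> is enlarged by the pairs
  \<open>(U M, V M)\<close> with \<open>M\<close> of degree exactly \<open>i\<close>; since
  \<open>U P + V Q\<close> has degree at most \<open>a\<close>, these still produce combinations of
  degree at most \<open>i + a\<close>. They add \<open>i + 1\<close> members, while raising the
  syzygy degree \<open>j\<close> by one costs only \<open>card Z + 2\<close>. Keeping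
  \<open>U\<close> and \<open>V\<close> abstract allows the roles of \<open>x\<close> and
  \<open>y\<close> to be exchanged.\<close>

lemma bezout_tangential_lead:
  fixes P Q U V :: bipoly
  assumes coprime: "coprime P Q" and lead: "lead_at Q s0 t0" and P: "tdeg_le P (s0 + t0)"
    and U: "lead_at U s1 t1" "s1 + t1 = 1" and V: "V \<noteq> 0"
    and UV: "tdeg_le (U * P + V * Q) (s0 + t0)"
    and Z: "finite Z" "\<And>z. z \<in> Z \<Longrightarrow> eval2 P (fst z) (snd z) = 0"
      "\<And>z. z \<in> Z \<Longrightarrow> eval2 Q (fst z) (snd z) = 0"
  shows "card Z + (s0 + t0) \<le> (s0 + t0)\<^sup>2 + 1"
proof -
  define a i where "a = s0 + t0" and "i = card Z + a"
  define T H :: "(nat \<times> nat) set" where "T = {(s, t). s + t < Suc i}" and "H = {(s, t). s + t = i}"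
  define A where "A = case_sum (\<lambda>p. monom2 (fst p) (snd p))
    (case_sum (\<lambda>p :: nat \<times> nat. 0) (\<lambda>p. U * monom2 (fst p) (snd p)))"
  define B where "B = case_sum (\<lambda>p :: nat \<times> nat. 0)
    (case_sum (\<lambda>p. monom2 (fst p) (snd p)) (\<lambda>p. V * monom2 (fst p) (snd p)))"
  have T: "finite T" and H: "finite H"
    unfolding T_def H_def by (rule finite_triangle finite_antidiagonal)+
  have Q: "tdeg_le Q a"
    using lead by (simp add: a_def tdeg_le_iff_lead_at)
  have U1: "tdeg_le U 1"
    using U by (simp add: tdeg_le_iff_lead_at)
  have mon: "tdeg_le (monom2 (fst p) (snd p)) i" if "p \<in> T \<union> H" for p
    using that by (intro tdeg_le_monom2) (auto simp: T_def H_def)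
  define I where "I = T <+> T <+> H"
  have "card Z + card I \<le>
    card {(s, t). s + t < Suc (i + a)} + card {(s, t). s + t < Suc (card Z + 1)}"
  proof (rule card_zeros_plus_card_family_le[OF coprime lead Z])
    show "finite I"
      using T H by (simp add: I_def)
    show "tdeg_le (A u) (card Z + 1 + s0 + t0)" if "u \<in> I" for u
    proof -
      have "tdeg_le (A u) (1 + i)"
        using that mon U1 tdeg_le_mult[of U 1 _ i]
        by (auto simp: A_def I_def intro: tdeg_le_mono[of _ i])
      then show ?thesis
        by (simp add: i_def a_def add_ac)
    qed
    show "tdeg_le (A u * P + B u * Q) (i + a)" if "u \<in> I" for u
    proof -
      have "tdeg_le (monom2 (fst p) (snd p) * (U * P + V * Q)) (i + a)" if "p \<in> H" for p
        using that mon UV by (intro tdeg_le_mult) (auto simp: a_def)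
      moreover have "tdeg_le (monom2 (fst p) (snd p) * P) (i + a)"
        "tdeg_le (monom2 (fst p) (snd p) * Q) (i + a)" if "p \<in> T" for p
        using that mon P Q by (auto intro!: tdeg_le_mult simp: a_def)
      ultimately show ?thesis
        using that by (auto simp: A_def B_def I_def algebra_simps)
    qed
    show "\<forall>u\<in>I. c u = 0"
      if sum: "(\<Sum>u\<in>I. const2 (c u) * A u) = 0" "(\<Sum>u\<in>I. const2 (c u) * B u) = 0" for c
    proof -
      define C where "C = (\<Sum>p\<in>H. const2 (c (Inr (Inr p))) * monom2 (fst p) (snd p))"
      define A0 where "A0 = (\<Sum>p\<in>T. const2 (c (Inl p)) * monom2 (fst p) (snd p))"
      define B0 where "B0 = (\<Sum>p\<in>T. const2 (c (Inr (Inl p))) * monom2 (fst p) (snd p))"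
      have AB: "A0 + U * C = 0" "B0 + V * C = 0"
        using sum T H
        by (simp_all add: I_def sum.Plus A_def B_def A0_def B0_def C_def sum_distrib_left mult_ac)
      \<comment> \<open>\<open>C\<close> is homogeneous of degree \<open>i\<close>, so if it were
        nonzero \<open>U * C\<close> would have degree \<open>i + 1\<close>, which \<open>A0\<close>
        of degree at most \<open>i\<close> cannot cancel.\<close>
      have "C = 0"
      proof (rule ccontr)
        assume "C \<noteq> 0"
        then obtain s t where st: "lead_at C s t"
          by (rule lead_at_exists)
        then have "s + t = i"
          using coeff2_monom_combination[OF H, of "\<lambda>p. c (Inr (Inr p))" s t]
          by (auto simp: lead_at_def C_def H_def split: if_splits)
        moreover have "tdeg_le A0 i"
          unfolding A0_def using mon by (intro tdeg_le_sum tdeg_le_scale) simp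
        then have "tdeg_le (U * C) i"
          using AB(1) tdeg_le_uminus[of A0 i] by (simp add: add_eq_0_iff)
        then have "s1 + s + (t1 + t) \<le> i"
          using lead_at_mult[OF U(1) st] by (simp add: tdeg_le_iff_lead_at)
        ultimately show False
          using U(2) by simp
      qed
      with AB have "A0 = 0" "B0 = 0"
        by simp_all
      with \<open>C = 0\<close> show ?thesis
        using monom_combination_eq_0[OF T, of "\<lambda>p. c (Inl p)"]
          monom_combination_eq_0[OF T, of "\<lambda>p. c (Inr (Inl p))"]
          monom_combination_eq_0[OF H, of "\<lambda>p. c (Inr (Inr p))"]
        by (auto simp: I_def A0_def B0_def C_def)
    qed
  qed (auto simp: i_def)
  then have "2 * card Z + 2 * (2 * card T) + 2 * card H \<le>
      2 * card {(s, t). s + t < Suc (i + a)} + 2 * card {(s, t). s + t < Suc (card Z + 1)}"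
    using T H by (simp add: card_Plus I_def)
  then have "2 * card Z + 2 * (Suc i * (Suc i + 1)) + 2 * Suc i \<le>
      Suc (i + a) * (Suc (i + a) + 1) + Suc (card Z + 1) * (Suc (card Z + 1) + 1)"
    unfolding T_def H_def card_triangle card_antidiagonal .
  then have "card Z + a \<le> a\<^sup>2 + 1"
    by (simp add: i_def power2_eq_square algebra_simps)
  then show ?thesis
    by (simp add: a_def)
qed

text \<open>By symmetry the polynomial of larger degree serves as \<open>Q\<close> in
  \<open>bezout_lead\<close>. If one polynomial is zero, coprimality makes the other a unit, which
  has no zeros.\<close>

lemma bezout:
  fixes P Q :: bipoly
  assumes coprime: "coprime P Q" and P: "tdeg_le P a" and Q: "tdeg_le Q a"
    and Z: "finite Z" "\<And>z. z \<in> Z \<Longrightarrow> eval2 P (fst z) (snd z) = 0"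
      "\<And>z. z \<in> Z \<Longrightarrow> eval2 Q (fst z) (snd z) = 0"
  shows "card Z \<le> a\<^sup>2"
proof -
  consider "P = 0" | "Q = 0" | s t s' t' where "lead_at P s t" "lead_at Q s' t'"
    using lead_at_exists by metis
  then show ?thesis
  proof cases
    case 1
    then have "is_unit Q" using coprime by simp
    then obtain R where "1 = Q * R" by (elim dvdE)
    then have "Z = {}" using Z(3) by (metis eval2_simps(2,6) all_not_in_conv mult_zero_left zero_neq_one)
    then show ?thesis by simp
  next
    case 2
    then have "is_unit P" using coprime by simp
    then obtain R where "1 = P * R" by (elim dvdE)
    then have "Z = {}" using Z(2) by (metis eval2_simps(2,6) all_not_in_conv mult_zero_left zero_neq_one)
    then show ?thesis by simp
  next
    case 3
    then have le: "s + t \<le> a" "s' + t' \<le> a"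
      using P Q by (simp_all add: tdeg_le_iff_lead_at)
    show ?thesis
    proof (cases "s + t \<le> s' + t'")
      case True
      with 3 have "card Z \<le> (s' + t')\<^sup>2"
        using coprime Z by (intro bezout_lead[of P Q]) (auto simp: tdeg_le_iff_lead_at)
      with le show ?thesis
        using power_mono[OF le(2), of 2] by linarith
    next
      case False
      with 3 have "card Z \<le> (s + t)\<^sup>2"
        using coprime Z by (intro bezout_lead[of Q P]) (auto simp: tdeg_le_iff_lead_at coprime_commute)
      with le show ?thesis
        using power_mono[OF le(1), of 2] by linarith
    qed
  qed
qed

text \<open>If \<open>P\<close> or \<open>Q\<close> attains degree \<open>a\<close>, the refined
  count applies with that polynomial in the leading role. Otherwise both have degree at most
  \<open>a - 1\<close>, and the plain bound \<open>(a - 1)\<^sup>2\<close> is already small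
  enough.\<close>

lemma bezout_tangential:
  fixes P Q :: bipoly
  assumes coprime: "coprime P Q" and P: "tdeg_le P a" and Q: "tdeg_le Q a"
    and PQ: "tdeg_le (varx * P + vary * Q) a" and a: "a > 0"
    and Z: "finite Z" "\<And>z. z \<in> Z \<Longrightarrow> eval2 P (fst z) (snd z) = 0"
      "\<And>z. z \<in> Z \<Longrightarrow> eval2 Q (fst z) (snd z) = 0"
  shows "card Z + a \<le> a\<^sup>2 + 1"
proof -
  consider s t where "lead_at P s t" "s + t = a" | s t where "lead_at Q s t" "s + t = a"
    | "tdeg_le P (a - 1)" "tdeg_le Q (a - 1)"
  proof -
    have *: "tdeg_le f (a - 1) \<or> (\<exists>s t. lead_at f s t \<and> s + t = a)" if "tdeg_le f a" for f
    proof (cases "f = 0")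
      case False
      then obtain s t where "lead_at f s t" by (rule lead_at_exists)
      moreover from this have "s + t \<le> a"
        using that by (simp add: tdeg_le_iff_lead_at)
      moreover from this have "s + t \<le> a - 1 \<or> s + t = a"
        by linarith
      ultimately show ?thesis
        using tdeg_le_iff_lead_at by blast
    qed simp
    from *[OF P] *[OF Q] that show ?thesis by blast
  qed
  then show ?thesis
  proof cases
    case (1 s t)
    then show ?thesis
      using bezout_tangential_lead[of Q P s t vary 0 1 varx Z] coprime Z PQ Q lead_at_vary
        lead_at_nonzero[OF lead_at_varx]
      by (simp add: coprime_commute add.commute[of "varx * P"])
  next
    case (2 s t)
    then show ?thesis
      using bezout_tangential_lead[of P Q s t varx 1 0 vary Z] coprime Z PQ P lead_at_varx
        lead_at_nonzero[OF lead_at_vary]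
      by simp
  next
    case 3
    then have "card Z \<le> (a - 1)\<^sup>2"
      using bezout coprime Z by blast
    moreover obtain b where "a = Suc b"
      using a by (cases a) auto
    ultimately show ?thesis
      by (simp add: power2_eq_square)
  qed
qed

subsection \<open>Finite zero sets of a single polynomial\<close>

lemma eval2_pCons: "eval2 (pCons a f) x y = poly a x + y * eval2 f x y"
  by (simp add: eval2_def)

lemma DERIV_eval2: "((\<lambda>y. eval2 f x y) has_real_derivative eval2 (pderiv f) x y) (at y)"
proof (induction f)
  case 0
  show ?case by simp
next
  case (pCons a f)
  have "((\<lambda>y. poly a x + y * eval2 f x y) has_real_derivative
      0 + (1 * eval2 f x y + eval2 (pderiv f) x y * y)) (at y)"
    by (intro DERIV_add DERIV_const DERIV_mult DERIV_ident pCons.IH)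
  then show ?case
    by (simp add: eval2_pCons pderiv_pCons mult.commute)
qed

lemma isCont_eval2_fst: "isCont (\<lambda>x. eval2 f x y) x"
  unfolding eval2_def by (rule poly_isCont)

text \<open>Along the vertical line through the zero, \<open>f\<close> is negative just below and
  positive just above. By continuity these two signs persist for all nearby \<open>x\<close>, and
  the intermediate value theorem yields a zero above each such \<open>x\<close>.\<close>

lemma infinite_zeros_if_pderiv_pos:
  assumes f: "eval2 f x0 y0 = 0" and pos: "eval2 (pderiv f) x0 y0 > 0"
  shows "infinite {z. eval2 f (fst z) (snd z) = 0}"
proof
  assume fin: "finite {z. eval2 f (fst z) (snd z) = 0}"
  obtain d1 where d1: "d1 > 0" "\<And>h. 0 < h \<Longrightarrow> h < d1 \<Longrightarrow> eval2 f x0 y0 < eval2 f x0 (y0 + h)"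
    using DERIV_pos_inc_right[OF DERIV_eval2 pos] by auto
  obtain d2 where d2: "d2 > 0" "\<And>h. 0 < h \<Longrightarrow> h < d2 \<Longrightarrow> eval2 f x0 (y0 - h) < eval2 f x0 y0"
    using DERIV_pos_inc_left[OF DERIV_eval2 pos] by auto
  define h where "h = min d1 d2 / 2"
  have h: "h > 0" "eval2 f x0 (y0 + h) > 0" "eval2 f x0 (y0 - h) < 0"
    using d1 d2 f by (auto simp: h_def)
  have "\<forall>\<^sub>F x in at x0. eval2 f x (y0 + h) > 0 \<and> eval2 f x (y0 - h) < 0"
    using isCont_eval2_fst[unfolded isCont_def, of f] h(2,3)
    by (intro eventually_conj order_tendstoD)
  then obtain e where e: "e > 0"
    "\<And>x. x \<noteq> x0 \<Longrightarrow> dist x x0 < e \<Longrightarrow> eval2 f x (y0 + h) > 0 \<and> eval2 f x (y0 - h) < 0"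
    unfolding eventually_at by auto
  have "x \<in> fst ` {z. eval2 f (fst z) (snd z) = 0}" if "x \<in> {x0<..<x0 + e}" for x
  proof -
    have x: "eval2 f x (y0 - h) \<le> 0" "0 \<le> eval2 f x (y0 + h)"
      using e(2)[of x] that by (auto simp: dist_real_def)
    have "\<exists>y\<ge>y0 - h. y \<le> y0 + h \<and> eval2 f x y = 0"
      using x h(1) by (intro IVT) (auto intro: DERIV_isCont[OF DERIV_eval2])
    then obtain y where "eval2 f x y = 0"
      by blast
    then show ?thesis
      by (intro image_eqI[of _ _ "(x, y)"]) simp_all
  qed
  then have "{x0<..<x0 + e} \<subseteq> fst ` {z. eval2 f (fst z) (snd z) = 0}"
    by blast
  then have "finite {x0<..<x0 + e}"
    using fin finite_subset by blast
  with e(1) show False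
    by (simp add: infinite_Ioo)
qed

lemma pderiv_eq_0_at_finite_zeros:
  assumes fin: "finite {z. eval2 f (fst z) (snd z) = 0}" and "eval2 f x y = 0"
  shows "eval2 (pderiv f) x y = 0"
proof (rule ccontr)
  assume "eval2 (pderiv f) x y \<noteq> 0"
  then consider "eval2 (pderiv f) x y > 0" | "eval2 (pderiv (- f)) x y > 0"
    by (auto simp: pderiv_minus neq_iff)
  then show False
  proof cases
    case 1
    then show ?thesis
      using infinite_zeros_if_pderiv_pos[of f] assms by blast
  next
    case 2
    then show ?thesis
      using infinite_zeros_if_pderiv_pos[of "- f"] assms by simp
  qed
qed

text \<open>Induction on the degree in \<open>y\<close>. With \<open>g\<close> the gcd of
  \<open>f\<close> and its \<open>y\<close>-derivative, a zero of \<open>f\<close> is a zero of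
  \<open>g\<close>, which has smaller \<open>y\<close>-degree, or a common zero of the two coprime
  cofactors, which \<open>bezout\<close> counts. The two squares add up to at most the square of the
  sum.\<close>

lemma card_finite_zeros_le:
  fixes f :: bipoly
  assumes "finite {z. eval2 f (fst z) (snd z) = 0}" "lead_at f s t"
  shows "card {z. eval2 f (fst z) (snd z) = 0} \<le> (s + t)\<^sup>2"
  using assms
proof (induction "degree f" arbitrary: f s t rule: less_induct)
  case less
  define Z where "Z = (\<lambda>f. {z. eval2 f (fst z) (snd z) = 0})"
  have fin: "finite (Z f)"
    using less.prems by (simp add: Z_def)
  have f0: "f \<noteq> 0"
    using less.prems lead_at_nonzero by blast
  show ?case
  proof (cases "pderiv f = 0")
    case True
    then obtain c where c: "f = [:c:]"
      by (auto simp: pderiv_eq_0_iff elim: degree_eq_zeroE)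
    \<comment> \<open>Here \<open>f\<close> depends on \<open>x\<close> only, so a single zero would
      bring a whole vertical line of zeros.\<close>
    have "Z f = {}"
    proof (rule ccontr)
      assume "Z f \<noteq> {}"
      then obtain x where x: "poly c x = 0"
        by (auto simp: Z_def c eval2_def)
      then have "range (Pair x) \<subseteq> Z f"
        by (auto simp: Z_def c eval2_def)
      then have "finite (range (Pair x :: real \<Rightarrow> _))"
        using fin finite_subset by blast
      then show False
        using finite_imageD[of "Pair x" "UNIV :: real set"] by (simp add: infinite_UNIV_char_0 inj_on_def)
    qed
    then show ?thesis
      by (simp add: Z_def)
  next
    case False
    define g where "g = gcd f (pderiv f)"
    obtain h k where hk: "f = h * g" "pderiv f = k * g" "coprime h k"
      using gcd_coprime_exists[of f "pderiv f"] f0 unfolding g_def by auto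
    have "degree g \<le> degree (pderiv f)"
      using False hk(2) by (intro dvd_imp_degree_le) auto
    moreover have "degree f \<noteq> 0"
      using False by (simp add: pderiv_eq_0_iff)
    ultimately have deg: "degree g < degree f"
      by (simp add: degree_pderiv)
    have "g \<noteq> 0" "h \<noteq> 0" "k \<noteq> 0"
      using hk f0 False by auto
    then obtain s1 t1 s2 t2 s3 t3 where
      lead: "lead_at g s1 t1" "lead_at h s2 t2" "lead_at k s3 t3"
      using lead_at_exists by metis
    have tf: "tdeg_le f d \<longleftrightarrow> s2 + s1 + (t2 + t1) \<le> d" for d
      unfolding hk(1) by (rule tdeg_le_iff_lead_at[OF lead_at_mult[OF lead(2,1)]])
    then have st: "s + t = s2 + s1 + (t2 + t1)"
      using tdeg_le_iff_lead_at[OF less.prems(2)] by (metis le_antisym order_refl)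
    have "tdeg_le (pderiv f) (s + t)"
      using tdeg_le_iff_lead_at[OF less.prems(2), of "s + t"]
      by (auto simp: tdeg_le_def coeff2_def coeff_pderiv of_nat_poly)
    \<comment> \<open>Differentiation does not raise the total degree, so after division by
      \<open>g\<close> the cofactor \<open>k\<close> has at most the degree of
      \<open>h\<close>.\<close>
    then have tk: "tdeg_le k (s2 + t2)"
      using lead_at_mult[OF lead(3,1)] st
      by (simp add: hk(2) tdeg_le_iff_lead_at tdeg_le_iff_lead_at[OF lead(3)])
    have sub: "Z g \<subseteq> Z f" "Z h \<subseteq> Z f"
      by (auto simp: Z_def hk(1))
    then have fing: "finite (Z g)" and finh: "finite (Z h \<inter> Z k)"
      using fin finite_subset by blast+
    have "Z f \<subseteq> Z g \<union> (Z h \<inter> Z k)"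
    proof
      fix z assume z: "z \<in> Z f"
      then have "eval2 (pderiv f) (fst z) (snd z) = 0"
        using fin by (intro pderiv_eq_0_at_finite_zeros) (auto simp: Z_def)
      with z have "eval2 (h * g) (fst z) (snd z) = 0" "eval2 (k * g) (fst z) (snd z) = 0"
        by (simp_all add: Z_def flip: hk(1,2))
      then show "z \<in> Z g \<union> (Z h \<inter> Z k)"
        by (auto simp: Z_def)
    qed
    then have "card (Z f) \<le> card (Z g \<union> (Z h \<inter> Z k))"
      using fing finh by (intro card_mono) auto
    also have "\<dots> \<le> card (Z g) + card (Z h \<inter> Z k)"
      by (rule card_Un_le)
    also have "\<dots> \<le> (s1 + t1)\<^sup>2 + (s2 + t2)\<^sup>2"
    proof (rule add_mono)
      show "card (Z g) \<le> (s1 + t1)\<^sup>2"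
        using less.hyps[OF deg _ lead(1)] fing by (simp add: Z_def)
      show "card (Z h \<inter> Z k) \<le> (s2 + t2)\<^sup>2"
        using hk(3) tk lead(2) finh
        by (intro bezout[of h k]) (auto simp: Z_def tdeg_le_iff_lead_at)
    qed
    also have "\<dots> \<le> (s + t)\<^sup>2"
      by (simp add: st power2_eq_square algebra_simps)
    finally show ?thesis
      by (simp add: Z_def)
  qed
qed

subsection \<open>Tangential pairs\<close>

lemma coeff2_varx_mult: "coeff2 (varx * f) (Suc s) t = coeff2 f s t" "coeff2 (varx * f) 0 t = 0"
  by (simp_all add: coeff2_def varx_def)

lemma coeff2_vary_mult: "coeff2 (vary * f) s (Suc t) = coeff2 f s t" "coeff2 (vary * f) s 0 = 0"
  by (simp_all add: coeff2_def vary_def)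

text \<open>Total degrees add under multiplication because leading exponents do. The second claim
  shows that the subtraction in the first is not truncated when \<open>g\<close> is nonzero.\<close>

lemma tdeg_le_cancel:
  assumes "lead_at f s t" "tdeg_le (g * f) n"
  shows "tdeg_le g (n - (s + t))" "g \<noteq> 0 \<Longrightarrow> s + t \<le> n"
proof -
  have *: "tdeg_le g (n - (s + t)) \<and> s + t \<le> n" if g: "g \<noteq> 0"
  proof -
    obtain s' t' where "lead_at g s' t'"
      using lead_at_exists[OF g] .
    with lead_at_mult[OF this assms(1)] assms(2) show ?thesis
      by (simp add: tdeg_le_iff_lead_at)
  qed
  show "tdeg_le g (n - (s + t))"
    using * by (cases "g = 0") auto
  show "s + t \<le> n" if "g \<noteq> 0"
    using *[OF that] by simp
qed

text \<open>For constants \<open>P\<close> and \<open>Q\<close> the coefficients of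
  \<open>x P + y Q\<close> at \<open>x\<close> and \<open>y\<close> are \<open>P\<close> and
  \<open>Q\<close> themselves. This excludes cofactors of degree bound 0 once the gcd is split
  off.\<close>

lemma tdeg_le_0_tangential:
  assumes "tdeg_le P 0" "tdeg_le Q 0" "tdeg_le (varx * P + vary * Q) 0"
  shows "P = 0" "Q = 0"
proof -
  have "coeff2 (varx * P + vary * Q) 1 0 = 0" "coeff2 (varx * P + vary * Q) 0 1 = 0"
    using assms(3) by (simp_all add: tdeg_le_def)
  then have "coeff2 P 0 0 = 0" "coeff2 Q 0 0 = 0"
    by (simp_all add: coeff2_varx_mult coeff2_vary_mult)
  moreover have "f = 0" if "tdeg_le f 0" "coeff2 f 0 0 = 0" for f
  proof (rule bipoly_eqI)
    fix s t
    show "coeff2 f s t = coeff2 0 s t"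
      using that by (cases "s = 0 \<and> t = 0") (auto simp: tdeg_le_def)
  qed
  ultimately show "P = 0" "Q = 0"
    using assms(1,2) by blast+
qed

lemma card_common_zeros_tangential_le:
  fixes P Q :: bipoly
  defines "Z \<equiv> {z. eval2 P (fst z) (snd z) = 0 \<and> eval2 Q (fst z) (snd z) = 0}"
  assumes P: "tdeg_le P n" and Q: "tdeg_le Q n" and PQ: "tdeg_le (varx * P + vary * Q) n"
    and fin: "finite Z"
  shows "card Z + n \<le> n\<^sup>2 + 1"
proof -
  have "P \<noteq> 0 \<or> Q \<noteq> 0"
  proof (rule ccontr)
    assume "\<not> ?thesis"
    then have "Z = UNIV" by (simp add: Z_def)
    with fin have "finite (UNIV :: (real \<times> real) set)" by simp
    then show False
      by (simp add: finite_prod infinite_UNIV_char_0)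
  qed
  define f where "f = gcd P Q"
  obtain P' Q' where PQ': "P = P' * f" "Q = Q' * f" "coprime P' Q'"
    using gcd_coprime_exists[of P Q] \<open>P \<noteq> 0 \<or> Q \<noteq> 0\<close> unfolding f_def by auto
  have "f \<noteq> 0" "P' \<noteq> 0 \<or> Q' \<noteq> 0"
    using \<open>P \<noteq> 0 \<or> Q \<noteq> 0\<close> PQ' by auto
  then obtain s t where lead: "lead_at f s t"
    using lead_at_exists by metis
  define d m where "d = s + t" and "m = n - d"
  \<comment> \<open>The tangency condition passes to the cofactors, with the degree bound lowered by
    the degree of the gcd.\<close>
  have "varx * P + vary * Q = (varx * P' + vary * Q') * f"
    by (simp add: PQ' algebra_simps)
  then have deg: "tdeg_le P' m" "tdeg_le Q' m" "tdeg_le (varx * P' + vary * Q') m"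
    using tdeg_le_cancel(1)[OF lead] P Q PQ PQ' unfolding m_def d_def by metis+
  have "d \<le> n"
    using tdeg_le_cancel(2)[OF lead] P Q PQ' \<open>P' \<noteq> 0 \<or> Q' \<noteq> 0\<close> unfolding d_def by metis
  then have n: "n = m + d"
    by (simp add: m_def)
  have m: "m > 0"
    using tdeg_le_0_tangential[of P' Q'] deg \<open>P' \<noteq> 0 \<or> Q' \<noteq> 0\<close> by (cases m) auto
  define Zf where "Zf = {z. eval2 f (fst z) (snd z) = 0}"
  define Z' where "Z' = {z. eval2 P' (fst z) (snd z) = 0 \<and> eval2 Q' (fst z) (snd z) = 0}"
  have Z: "Z = Zf \<union> Z'"
    by (auto simp: Z_def Zf_def Z'_def PQ')
  with fin have finZ: "finite Zf" "finite Z'"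
    by auto
  have "card Z' + m \<le> m\<^sup>2 + 1"
    using PQ'(3) deg m finZ(2) by (rule bezout_tangential) (auto simp: Z'_def)
  moreover have "card Zf \<le> d\<^sup>2"
    using card_finite_zeros_le[OF _ lead] finZ(1) by (simp add: Zf_def d_def)
  moreover have "card Z \<le> card Zf + card Z'"
    unfolding Z by (rule card_Un_le)
  ultimately have "card Z + m \<le> m\<^sup>2 + 1 + d\<^sup>2"
    by linarith
  \<comment> \<open>Since \<open>n = m + d\<close>, the slack between the two bounds is
    \<open>2 * m * d - d\<close>, which is nonnegative because \<open>m\<close> is positive.\<close>
  moreover have "d \<le> m * d"
    using m by (cases m) auto
  moreover have "n\<^sup>2 = m\<^sup>2 + d\<^sup>2 + 2 * (m * d)"
    by (simp add: n power2_eq_square algebra_simps)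
  ultimately show ?thesis
    using n by linarith
qed

subsection \<open>Passing to the chart\<close>

text \<open>Parametrises the affine plane on which \<open>v $ 3 - a * v $ 1 - b * v $ 2\<close>
  equals 1; the lines through the origin that miss it are those where this form vanishes.\<close>

definition chart :: "real \<Rightarrow> real \<Rightarrow> real \<times> real \<Rightarrow> real^3" where
  "chart a b z = vector [fst z, snd z, 1 + a * fst z + b * snd z]"

lemma chart_nth [simp]:
  "chart a b z $ 1 = fst z" "chart a b z $ 2 = snd z" "chart a b z $ 3 = 1 + a * fst z + b * snd z"
  by (simp_all add: chart_def)

lemma chart_nonzero: "chart a b z \<noteq> 0"
  by (auto simp: vec_eq_iff forall_3)

lemma homogeneous_polynomial_scaleR:
  assumes "homogeneous_polynomial n f"
  shows "f (r *\<^sub>R v) = r ^ n * f v"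
proof -
  obtain c where c: "\<And>v. f v = (\<Sum>(i, j, k)\<in>monomial_exponents n.
      c i j k * (v $ 1) ^ i * (v $ 2) ^ j * (v $ 3) ^ k)"
    using assms by (auto simp: homogeneous_polynomial_def)
  show ?thesis
    unfolding c sum_distrib_left
    by (intro sum.cong) (auto simp: monomial_exponents_def power_mult_distrib power_add)
qed

lemma homogeneous_polynomial_chart:
  assumes "homogeneous_polynomial n f"
  obtains p where "tdeg_le p n" "\<And>z. eval2 p (fst z) (snd z) = f (chart a b z)"
proof -
  obtain c where c: "\<And>v. f v = (\<Sum>(i, j, k)\<in>monomial_exponents n.
      c i j k * (v $ 1) ^ i * (v $ 2) ^ j * (v $ 3) ^ k)"
    using assms by (auto simp: homogeneous_polynomial_def)
  define w where "w = 1 + const2 a * varx + const2 b * vary"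
  define p where "p = (\<Sum>(i, j, k)\<in>monomial_exponents n.
      const2 (c i j k) * varx ^ i * vary ^ j * w ^ k)"
  have w: "tdeg_le w 1"
    unfolding w_def by (intro tdeg_le_add tdeg_le_scale tdeg_le_const tdeg_le_varx tdeg_le_vary)
  have "tdeg_le (const2 c * varx ^ i * vary ^ j * w ^ k) (i + j + k)" for c i j k
    by (intro tdeg_le_mult tdeg_le_scale tdeg_le_power tdeg_le_varx tdeg_le_vary w)
  then have "tdeg_le p n"
    unfolding p_def by (intro tdeg_le_sum) (auto simp: monomial_exponents_def)
  moreover have "eval2 p (fst z) (snd z) = f (chart a b z)" for z
    unfolding c p_def eval2_sum by (intro sum.cong) (auto simp: w_def)
  ultimately show ?thesis
    by (rule that)
qed

text \<open>Both sides are homogeneous, so tangency on the unit sphere scales by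
  \<open>norm v ^ (n + 1)\<close> to every vector.\<close>

lemma homogeneous_vector_field_tangential:
  assumes "homogeneous_vector_field_on_sphere n X"
  shows "v $ 1 * X v $ 1 + v $ 2 * X v $ 2 + v $ 3 * X v $ 3 = 0"
proof (cases "v = 0")
  case False
  define u where "u = sgn v"
  have v: "v = norm v *\<^sub>R u"
    using False by (simp add: u_def sgn_div_norm)
  have X: "X v $ i = norm v ^ n * X u $ i" for i
    using assms homogeneous_polynomial_scaleR[of n "\<lambda>v. X v $ i" "norm v" u]
    by (simp add: homogeneous_vector_field_on_sphere_def flip: v)
  have "u \<in> sphere 0 1"
    using False by (simp add: u_def norm_sgn)
  then have "u $ 1 * X u $ 1 + u $ 2 * X u $ 2 + u $ 3 * X u $ 3 = 0"
    using assms by (simp add: homogeneous_vector_field_on_sphere_def)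
  then have "norm v * norm v ^ n * (u $ 1 * X u $ 1 + u $ 2 * X u $ 2 + u $ 3 * X u $ 3) = 0"
    by simp
  moreover have "v $ i = norm v * u $ i" for i
    using v by (metis vector_scaleR_component real_scaleR_def)
  ultimately show ?thesis
    by (simp add: X algebra_simps)
qed simp

text \<open>Taking \<open>(a, b) = (t, t\<^sup>2)\<close> turns each condition into the nonvanishing
  at \<open>t\<close> of a nonzero polynomial, so only finitely many \<open>t\<close> are
  bad.\<close>

lemma generic_line_avoiding:
  fixes S :: "(real^3) set"
  assumes "finite S" "0 \<notin> S"
  obtains a b where "\<And>v. v \<in> S \<Longrightarrow> v $ 3 - a * v $ 1 - b * v $ 2 \<noteq> 0"
proof -
  define q where "q = (\<lambda>v :: real^3. [:v $ 3, - v $ 1, - v $ 2:])"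
  have "q v \<noteq> 0" if "v \<in> S" for v
  proof
    assume "q v = 0"
    then have "v = 0"
      by (simp add: q_def vec_eq_iff forall_3)
    with that assms(2) show False
      by simp
  qed
  then have "finite (\<Union>v\<in>S. {t. poly (q v) t = 0})"
    using assms(1) by (intro finite_UN_I poly_roots_finite)
  then obtain t where "t \<notin> (\<Union>v\<in>S. {t. poly (q v) t = 0})"
    using ex_new_if_finite[OF infinite_UNIV_char_0] by blast
  then show ?thesis
    by (intro that[of t "t * t"]) (auto simp: q_def algebra_simps)
qed

theorem theorem7:
  fixes X :: "real^3 \<Rightarrow> real^3" and n :: nat
  assumes "homogeneous_vector_field_on_sphere n X"
    and "finite (sphere_singularities X)"
  shows "int (card (sphere_singularities X)) \<le> 2 * ((int n)\<^sup>2 - int n + 1)"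
proof -
  define S where "S = sphere_singularities X"
  have S: "finite S" "0 \<notin> S" and normS: "\<And>v. v \<in> S \<Longrightarrow> norm v = 1"
    using assms(2) by (auto simp: S_def sphere_singularities_def)
  obtain a b where ab: "\<And>v. v \<in> S \<Longrightarrow> v $ 3 - a * v $ 1 - b * v $ 2 \<noteq> 0"
    using generic_line_avoiding[OF S] by blast
  have hom: "homogeneous_polynomial n (\<lambda>v. X v $ i)" for i
    using assms(1) by (simp add: homogeneous_vector_field_on_sphere_def)
  have "\<exists>p. tdeg_le p n \<and> (\<forall>z. eval2 p (fst z) (snd z) = X (chart a b z) $ i)" for i
    using homogeneous_polynomial_chart[OF hom, of a b i] by blast
  then obtain p where p: "\<And>i. tdeg_le (p i) n"
    "\<And>i z. eval2 (p i) (fst z) (snd z) = X (chart a b z) $ i"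
    by metis
  \<comment> \<open>the first two components of \<open>M\<^sup>T X(M v)\<close> for the shear \<open>M (x, y, z) = (x, y, z + a x + b y)\<close>\<close>
  define P Q where "P = p 1 + const2 a * p 3" and "Q = p 2 + const2 b * p 3"
  define Z where "Z = {z. eval2 P (fst z) (snd z) = 0 \<and> eval2 Q (fst z) (snd z) = 0}"
  \<comment> \<open>Tangency at \<open>chart a b (x, y)\<close>, regrouped. It bounds the degree of
    \<open>x P + y Q\<close> by \<open>n\<close> and forces the third component of \<open>X\<close>
    to vanish wherever \<open>P\<close> and \<open>Q\<close> do.\<close>
  have "varx * P + vary * Q + p 3 = 0"
  proof (rule eq_0_if_eval2_eq_0)
    fix x y
    show "eval2 (varx * P + vary * Q + p 3) x y = 0"
      using homogeneous_vector_field_tangential[OF assms(1), of "chart a b (x, y)"] p(2)[of _ "(x, y)"]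
      by (simp add: P_def Q_def algebra_simps)
  qed
  then have p3: "varx * P + vary * Q = - p 3"
    by (simp add: add_eq_0_iff2)
  have Z: "z \<in> Z \<longleftrightarrow> X (chart a b z) = 0" for z
  proof
    assume z: "z \<in> Z"
    have "eval2 (varx * P + vary * Q) (fst z) (snd z) = 0"
      using z by (simp add: Z_def)
    then have "X (chart a b z) $ 3 = 0"
      unfolding p3 by (simp add: p(2))
    with z show "X (chart a b z) = 0"
      by (simp add: Z_def P_def Q_def p(2) vec_eq_iff forall_3)
  next
    assume "X (chart a b z) = 0"
    then show "z \<in> Z"
      by (simp add: Z_def P_def Q_def p(2))
  qed
  have X: "X (r *\<^sub>R v) = r ^ n *\<^sub>R X v" for r v
    using homogeneous_polynomial_scaleR[OF hom] by (simp add: vec_eq_iff)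
  \<comment> \<open>Central projection from the origin onto the chart plane; the denominator is
    nonzero on \<open>S\<close> by the choice of \<open>a\<close> and \<open>b\<close>.\<close>
  define h where "h = (\<lambda>v :: real^3. (v $ 1 / (v $ 3 - a * v $ 1 - b * v $ 2), v $ 2 / (v $ 3 - a * v $ 1 - b * v $ 2)))"
  have h: "chart a b (h v) = inverse (v $ 3 - a * v $ 1 - b * v $ 2) *\<^sub>R v" if "v \<in> S" for v
  proof -
    define w where "w = v $ 3 - a * v $ 1 - b * v $ 2"
    have "w \<noteq> 0" "v $ 3 = w + a * v $ 1 + b * v $ 2"
      using ab[OF that] by (simp_all add: w_def)
    then show ?thesis
      unfolding h_def w_def[symmetric] by (simp add: vec_eq_iff forall_3 field_simps)
  qed
  \<comment> \<open>Normalising a chart point gives a singularity that \<open>h\<close> projects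
    back to it; hence \<open>Z\<close> inherits finiteness from \<open>S\<close>.\<close>
  have "z \<in> h ` S" if "z \<in> Z" for z
  proof
    have "X (sgn (chart a b z)) = 0"
      using that by (simp add: Z sgn_div_norm X)
    then show "sgn (chart a b z) \<in> S"
      by (simp add: S_def sphere_singularities_def norm_sgn chart_nonzero)
    have "norm (chart a b z) \<noteq> 0"
      by (simp add: chart_nonzero)
    then show "z = h (sgn (chart a b z))"
      by (simp add: h_def sgn_div_norm prod_eq_iff field_simps)
  qed
  then have finZ: "finite Z"
    using S(1) finite_subset[of Z "h ` S"] by blast
  have card_Z: "card Z + n \<le> n\<^sup>2 + 1"
    unfolding Z_def
  proof (rule card_common_zeros_tangential_le)
    show "tdeg_le P n" "tdeg_le Q n"
      unfolding P_def Q_def by (intro tdeg_le_add tdeg_le_scale p(1))+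
    show "tdeg_le (varx * P + vary * Q) n"
      unfolding p3 by (intro tdeg_le_uminus p(1))
  qed (use finZ in \<open>simp add: Z_def\<close>)
  \<comment> \<open>Each line through the origin meets the sphere in an antipodal pair, which gives
    the factor 2; the sign of \<open>v $ 3 - a * v $ 1 - b * v $ 2\<close> decides which of the two
    points \<open>v\<close> is.\<close>
  have "S \<subseteq> (\<lambda>z. sgn (chart a b z)) ` Z \<union> (\<lambda>z. - sgn (chart a b z)) ` Z"
  proof
    fix v assume v: "v \<in> S"
    then have "X v = 0"
      by (simp add: S_def sphere_singularities_def)
    with v have "h v \<in> Z"
      by (simp add: Z h X)
    moreover have "v = sgn (chart a b (h v)) \<or> v = - sgn (chart a b (h v))"
    proof -
      have "sgn (chart a b (h v)) = sgn (inverse (v $ 3 - a * v $ 1 - b * v $ 2)) *\<^sub>R v"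
        using normS[OF v] by (simp add: h[OF v] sgn_scaleR sgn_div_norm[of v])
      then show ?thesis
        using ab[OF v] by (simp add: sgn_if)
    qed
    ultimately show "v \<in> (\<lambda>z. sgn (chart a b z)) ` Z \<union> (\<lambda>z. - sgn (chart a b z)) ` Z"
      by blast
  qed
  then have "card S \<le> card ((\<lambda>z. sgn (chart a b z)) ` Z \<union> (\<lambda>z. - sgn (chart a b z)) ` Z)"
    using finZ by (intro card_mono) auto
  also have "\<dots> \<le> card ((\<lambda>z. sgn (chart a b z)) ` Z) + card ((\<lambda>z. - sgn (chart a b z)) ` Z)"
    by (rule card_Un_le)
  also have "\<dots> \<le> card Z + card Z"
    using finZ by (intro add_mono card_image_le)
  finally have "int (card S) \<le> 2 * int (card Z)"
    by simp
  moreover have "int (card Z + n) \<le> int (n\<^sup>2 + 1)"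
    using card_Z by (simp only: of_nat_le_iff)
  ultimately show ?thesis
    by (simp add: S_def)
qed

end
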